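(* Let $\alpha=(\alpha_n)_{n\in\mathbb{N}}$ be a non-negative increasing sequence with $\lim_{n\to\infty}\alpha_n=\infty$. For every $\theta\in\Lambda_1(\alpha)$, the convolution operator $\widehat{T}_\theta:\Lambda_1(\alpha)\to\Lambda_1(\alpha)$ is topologizable. Moreover, for $\theta\in\Lambda_1(\alpha)$, the operator $\widehat{T}_\theta:\Lambda_1(\alpha)\to\Lambda_1(\alpha)$ is m-topologizable if and only if for every $p\in\mathbb{N}$ there exists $C_p>0$ such that $\|\theta^{*k}\|_p\le C_p^k$ for every $k\in\mathbb{N}$.
   Context: $\mathbb{N}=\{1,2,\dots\}$, $\mathbb{N}_0=\mathbb{N}\cup\{0\}$. The power series space of finite type is $\Lambda_1(\alpha)=\{x=(x_n)_{n\in\mathbb{N}}:\|x\|_k:=\sum_{n=1}^\infty|x_n|e^{-\frac1k\alpha_n}<\infty\text{ for all }k\in\mathbb{N}\}$, a Fréchet space with the increasing sequence of seminorms $(\|\cdot\|_k)_{k\in\mathbb{N}}$; $(e_n)_{n\in\mathbb{N}}$ is its canonical basis. Symbols are indexed from $0$: $\theta=(\theta_n)_{n\in\mathbb{N}_0}$ is regarded as the element of $\Lambda_1(\alpha)$ whose $n$-th coordinate ($n\in\mathbb{N}$) is $\theta_{n-1}$, so $\|\theta\|_k=\sum_{n=1}^\infty|\theta_{n-1}|e^{-\frac1k\alpha_n}$. The convolution operator $\widehat{T}_\theta$ is the continuous linear operator on $\Lambda_1(\alpha)$ with $\widehat{T}_\theta e_n=\sum_{j=n}^\infty\theta_{j-n}e_j$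 and $\widehat{T}_\theta x=\sum_{n=1}^\infty x_n\widehat{T}_\theta e_n$ (it is well-defined and continuous for every $\theta\in\Lambda_1(\alpha)$). Convolution of sequences indexed by $\mathbb{N}_0$: $(\theta*\phi)_m=\sum_{i=0}^m\theta_i\phi_{m-i}$; $\theta^{*k}=\theta*\cdots*\theta$ ($k$ factors). A continuous linear operator $T$ on a Fréchet space $E$ with increasing seminorms $(\|\cdot\|_p)_{p\in\mathbb{N}}$ is topologizable if for every $p\in\mathbb{N}$ there is $q\in\mathbb{N}$ such that for every $k\in\mathbb{N}$ there is $M_{k,p}>0$ with $\|T^kx\|_p\le M_{k,p}\|x\|_q$ for all $x\in E$. It is m-topologizable if for every $p\in\mathbb{N}$ there exist $q\in\mathbb{N}$ and $C_p\ge1$ with $\|T^kx\|_p\le C_p^k\|x\|_q$ for all $k\in\mathbb{N}$, $x\in E$. *)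

theory Defs
  imports "HOL-Analysis.Analysis"
begin

text \<open>
  All sequences (the exponent sequence \<open>\<alpha>\<close>, the elements of the space, the canonical basis) are
  indexed from 0: the coordinate with index \<open>n \<in> {1,2,...}\<close> is stored at position \<open>n - 1\<close>. Hence a
  symbol \<open>\<theta>\<close>, which is indexed from 0 anyway, is itself the element of the space it is identified
  with. Indices of seminorms and exponents of operators, in contrast, are not shifted: they range
  over \<open>{1,2,...}\<close>, and position 0 of a family of seminorms is never used.

  The scalars form an arbitrary \<open>real_normed_field\<close>, i.e. they are real or complex.
\<close>

definition Lambda1_norm :: "(nat \<Rightarrow> real) \<Rightarrow> nat \<Rightarrow> (nat \<Rightarrow> 'a::real_normed_field) \<Rightarrow> real" where
  "Lambda1_norm \<alpha> k x = (\<Sum>n. norm (x n) * exp (- (1 / real k) * \<alpha> n))"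

definition Lambda1 :: "(nat \<Rightarrow> real) \<Rightarrow> (nat \<Rightarrow> 'a::real_normed_field) set" where
  "Lambda1 \<alpha> = {x. \<forall>k\<ge>1. summable (\<lambda>n. norm (x n) * exp (- (1 / real k) * \<alpha> n))}"

text \<open>The locally convex topology on a space \<open>E\<close> of sequences given by the seminorms \<open>sn 1, sn 2, ...\<close>.\<close>

definition seminorm_topology ::
  "(nat \<Rightarrow> 'a::real_normed_field) set \<Rightarrow> (nat \<Rightarrow> (nat \<Rightarrow> 'a) \<Rightarrow> real) \<Rightarrow> (nat \<Rightarrow> 'a) topology" where
  "seminorm_topology E sn =
     topology_generated_by {{y \<in> E. sn k (\<lambda>n. y n - x n) < \<epsilon>} | x k \<epsilon>. x \<in> E \<and> k \<ge> 1 \<and> \<epsilon> > 0}"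

definition continuous_linear_operator ::
  "(nat \<Rightarrow> 'a::real_normed_field) set \<Rightarrow> (nat \<Rightarrow> (nat \<Rightarrow> 'a) \<Rightarrow> real)
    \<Rightarrow> ((nat \<Rightarrow> 'a) \<Rightarrow> nat \<Rightarrow> 'a) \<Rightarrow> bool" where
  "continuous_linear_operator E sn T \<longleftrightarrow>
     T ` E \<subseteq> E \<and>
     (\<forall>x\<in>E. \<forall>y\<in>E. T (\<lambda>n. x n + y n) = (\<lambda>n. T x n + T y n)) \<and>
     (\<forall>c. \<forall>x\<in>E. T (\<lambda>n. c * x n) = (\<lambda>n. c * T x n)) \<and>
     continuous_map (seminorm_topology E sn) (seminorm_topology E sn) T"

definition topologizable ::
  "(nat \<Rightarrow> 'a::real_normed_field) set \<Rightarrow> (nat \<Rightarrow> (nat \<Rightarrow> 'a) \<Rightarrow> real)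
    \<Rightarrow> ((nat \<Rightarrow> 'a) \<Rightarrow> nat \<Rightarrow> 'a) \<Rightarrow> bool" where
  "topologizable E sn T \<longleftrightarrow>
     continuous_linear_operator E sn T \<and>
     (\<forall>p\<ge>1. \<exists>q\<ge>1. \<forall>k\<ge>1. \<exists>M>0. \<forall>x\<in>E. sn p ((T ^^ k) x) \<le> M * sn q x)"

definition m_topologizable ::
  "(nat \<Rightarrow> 'a::real_normed_field) set \<Rightarrow> (nat \<Rightarrow> (nat \<Rightarrow> 'a) \<Rightarrow> real)
    \<Rightarrow> ((nat \<Rightarrow> 'a) \<Rightarrow> nat \<Rightarrow> 'a) \<Rightarrow> bool" where
  "m_topologizable E sn T \<longleftrightarrow>
     continuous_linear_operator E sn T \<and>
     (\<forall>p\<ge>1. \<exists>q\<ge>1. \<exists>C\<ge>1. \<forall>k\<ge>1. \<forall>x\<in>E. sn p ((T ^^ k) x) \<le> C ^ k * sn q x)"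

text \<open>
  Sum of a series of sequences with respect to a topology \<open>X\<close>; meaningful when the series converges
  and \<open>X\<close> is Hausdorff. The partial sums are formed coordinatewise.
\<close>

definition series_in :: "(nat \<Rightarrow> 'a::real_normed_field) topology \<Rightarrow> (nat \<Rightarrow> nat \<Rightarrow> 'a) \<Rightarrow> nat \<Rightarrow> 'a" where
  "series_in X f = (THE s. limitin X (\<lambda>N i. \<Sum>n\<le>N. f n i) s sequentially)"

definition unit_seq :: "nat \<Rightarrow> nat \<Rightarrow> 'a::real_normed_field" where
  "unit_seq n = (\<lambda>i. if i = n then 1 else 0)"

abbreviation Lambda1_topology :: "(nat \<Rightarrow> real) \<Rightarrow> (nat \<Rightarrow> 'a::real_normed_field) topology" where
  "Lambda1_topology \<alpha> \<equiv> seminorm_topology (Lambda1 \<alpha>) (Lambda1_norm \<alpha>)"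

text \<open>The image of the \<open>n\<close>-th basis vector: the sum of \<open>\<theta>\<^sub>j\<^sub>-\<^sub>n e\<^sub>j\<close> over \<open>j \<ge> n\<close>.\<close>

definition conv_operator_basis ::
  "(nat \<Rightarrow> real) \<Rightarrow> (nat \<Rightarrow> 'a::real_normed_field) \<Rightarrow> nat \<Rightarrow> nat \<Rightarrow> 'a" where
  "conv_operator_basis \<alpha> \<theta> n =
     series_in (Lambda1_topology \<alpha>) (\<lambda>j i. if n \<le> j then \<theta> (j - n) * unit_seq j i else 0)"

definition conv_operator ::
  "(nat \<Rightarrow> real) \<Rightarrow> (nat \<Rightarrow> 'a::real_normed_field) \<Rightarrow> (nat \<Rightarrow> 'a) \<Rightarrow> nat \<Rightarrow> 'a" where
  "conv_operator \<alpha> \<theta> x =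
     series_in (Lambda1_topology \<alpha>) (\<lambda>n i. x n * conv_operator_basis \<alpha> \<theta> n i)"

definition convolution ::
  "(nat \<Rightarrow> 'a::real_normed_field) \<Rightarrow> (nat \<Rightarrow> 'a) \<Rightarrow> nat \<Rightarrow> 'a" where
  "convolution \<theta> \<phi> m = (\<Sum>i\<le>m. \<theta> i * \<phi> (m - i))"

primrec conv_power :: "(nat \<Rightarrow> 'a::real_normed_field) \<Rightarrow> nat \<Rightarrow> nat \<Rightarrow> 'a" where
  "conv_power \<theta> 0 = unit_seq 0"
| "conv_power \<theta> (Suc k) = convolution \<theta> (conv_power \<theta> k)"

end

theory Submission imports Defs begin

text \<open>
  Write \<open>\<theta> * x\<close> for the convolution. The theorem rests on one estimate,
  \<open>\<parallel>\<theta> * x\<parallel>\<^sub>p \<le> \<parallel>\<theta>\<parallel>\<^sub>2\<^sub>p \<parallel>x\<parallel>\<^sub>2\<^sub>p\<close> (\<open>Lambda1_norm_convolution_le\<close>). It holds because \<open>\<alpha>\<close> is increasing: for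
  \<open>i + j = m\<close> both \<open>\<alpha>\<^sub>i\<close> and \<open>\<alpha>\<^sub>j\<close> are at most \<open>\<alpha>\<^sub>m\<close>, so the weight \<open>exp (- \<alpha>\<^sub>m / p)\<close> is at most
  \<open>exp (- \<alpha>\<^sub>i / 2p) exp (- \<alpha>\<^sub>j / 2p)\<close>, and the sum over all \<open>i\<close>, \<open>j\<close> of the resulting terms is a
  Cauchy product of two absolutely convergent series.

  The estimate says first that convolution by \<open>\<theta>\<close> is continuous on \<open>\<Lambda>\<^sub>1(\<alpha>)\<close>. As the truncations of
  \<open>x\<close> converge to \<open>x\<close> and the limits are unique, the operator, which is defined by series in the
  topology of the space, sends \<open>x\<close> to \<open>\<theta> * x\<close> (\<open>conv_operator_eq_convolution\<close>). By associativity its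
  \<open>k\<close>-th iterate is convolution by the \<open>k\<close>-th convolution power of \<open>\<theta>\<close>. The estimate, applied to that
  power, bounds the iterates on the seminorm \<open>p\<close> by the seminorm \<open>2p\<close>, where \<open>2p\<close> is independent of \<open>k\<close>:
  this is topologizability. The constants are the numbers \<open>\<parallel>\<theta>\<^sup>*\<^sup>k\<parallel>\<^sub>2\<^sub>p\<close>, so at most geometric growth of
  these gives m-topologizability. Conversely, \<open>\<theta>\<^sup>*\<^sup>k\<close> is the value of the \<open>k\<close>-th iterate at the first
  basis vector, whose seminorms are all at most 1 because \<open>\<alpha>\<close> is non-negative.
\<close>

section \<open>The seminorms\<close>

lemma Lambda1_summable:
  "x \<in> Lambda1 \<alpha> \<Longrightarrow> k \<ge> 1 \<Longrightarrow> summable (\<lambda>n. norm (x n) * exp (- (1 / real k) * \<alpha> n))"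
  unfolding Lambda1_def by blast

lemma Lambda1_norm_nonneg: "x \<in> Lambda1 \<alpha> \<Longrightarrow> k \<ge> 1 \<Longrightarrow> 0 \<le> Lambda1_norm \<alpha> k x"
  unfolding Lambda1_norm_def by (intro suminf_nonneg Lambda1_summable) auto

lemma Lambda1_norm_zero: "Lambda1_norm \<alpha> k (\<lambda>n. 0) = 0"
  by (simp add: Lambda1_norm_def)

lemma Lambda1_add:
  assumes "x \<in> Lambda1 \<alpha>" "y \<in> Lambda1 \<alpha>"
  shows Lambda1_add_closed: "(\<lambda>n. x n + y n) \<in> Lambda1 \<alpha>"
    and Lambda1_norm_triangle:
      "k \<ge> 1 \<Longrightarrow> Lambda1_norm \<alpha> k (\<lambda>n. x n + y n) \<le> Lambda1_norm \<alpha> k x + Lambda1_norm \<alpha> k y"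
proof -
  let ?w = "\<lambda>k x n. norm (x n :: 'a) * exp (- (1 / real k) * \<alpha> n)"
  have le: "?w k (\<lambda>n. x n + y n) n \<le> ?w k x n + ?w k y n" for k n
    unfolding distrib_right[symmetric] by (intro mult_right_mono norm_triangle_ineq) simp
  have sum: "summable (\<lambda>n. ?w k x n + ?w k y n)" if "k \<ge> 1" for k
    by (intro summable_add Lambda1_summable assms that)
  have sum': "summable (?w k (\<lambda>n. x n + y n))" if "k \<ge> 1" for k
    by (rule summable_comparison_test'[OF sum[OF that]]) (use le in auto)
  then show "(\<lambda>n. x n + y n) \<in> Lambda1 \<alpha>"
    by (simp add: Lambda1_def)
  assume k: "k \<ge> 1"
  have "Lambda1_norm \<alpha> k (\<lambda>n. x n + y n) \<le> (\<Sum>n. ?w k x n + ?w k y n)"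
    unfolding Lambda1_norm_def by (intro suminf_le le sum sum' k)
  also have "\<dots> = Lambda1_norm \<alpha> k x + Lambda1_norm \<alpha> k y"
    unfolding Lambda1_norm_def by (intro suminf_add[symmetric] Lambda1_summable assms k)
  finally show "Lambda1_norm \<alpha> k (\<lambda>n. x n + y n) \<le> Lambda1_norm \<alpha> k x + Lambda1_norm \<alpha> k y" .
qed

lemma Lambda1_uminus_closed: "x \<in> Lambda1 \<alpha> \<Longrightarrow> (\<lambda>n. - x n) \<in> Lambda1 \<alpha>"
  by (simp add: Lambda1_def)

lemma Lambda1_diff_closed:
  "x \<in> Lambda1 \<alpha> \<Longrightarrow> y \<in> Lambda1 \<alpha> \<Longrightarrow> (\<lambda>n. x n - y n) \<in> Lambda1 \<alpha>"
  using Lambda1_add_closed[OF _ Lambda1_uminus_closed, of x \<alpha> y] by simp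

lemma Lambda1_norm_triangle_diff:
  assumes "x \<in> Lambda1 \<alpha>" "y \<in> Lambda1 \<alpha>" "z \<in> Lambda1 \<alpha>" "k \<ge> 1"
  shows "Lambda1_norm \<alpha> k (\<lambda>n. x n - z n)
    \<le> Lambda1_norm \<alpha> k (\<lambda>n. x n - y n) + Lambda1_norm \<alpha> k (\<lambda>n. y n - z n)"
  using Lambda1_norm_triangle[OF Lambda1_diff_closed[OF assms(1,2)] Lambda1_diff_closed[OF assms(2,3)] assms(4)]
  by simp

lemma norm_coordinate_le_Lambda1_norm:
  assumes "x \<in> Lambda1 \<alpha>" "k \<ge> 1"
  shows "norm (x n) * exp (- (1 / real k) * \<alpha> n) \<le> Lambda1_norm \<alpha> k x"
  using sum_le_suminf[OF Lambda1_summable[OF assms], of "{n}"]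
  by (simp add: Lambda1_norm_def)

lemma finite_support_in_Lambda1:
  assumes "\<And>n. n > N \<Longrightarrow> x n = 0"
  shows "x \<in> Lambda1 \<alpha>"
  unfolding Lambda1_def using assms
  by (auto intro!: summable_finite[of "{..N}"]) (metis not_le)

lemma unit_seq_in_Lambda1: "unit_seq n \<in> Lambda1 \<alpha>"
  by (rule finite_support_in_Lambda1[of n]) (simp add: unit_seq_def)

lemma Lambda1_norm_unit_seq: "Lambda1_norm \<alpha> k (unit_seq n :: nat \<Rightarrow> 'a::real_normed_field) = exp (- (1 / real k) * \<alpha> n)"
proof -
  have "(\<lambda>i. norm (unit_seq n i :: 'a) * exp (- (1 / real k) * \<alpha> i))
      = (\<lambda>i. if i = n then exp (- (1 / real k) * \<alpha> i) else 0)"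
    by (auto simp: unit_seq_def)
  then show ?thesis
    unfolding Lambda1_norm_def by (simp only: sums_unique[OF sums_single, symmetric])
qed

section \<open>The topology of the space\<close>

definition Lambda1_ball ::
  "(nat \<Rightarrow> real) \<Rightarrow> nat \<Rightarrow> (nat \<Rightarrow> 'a::real_normed_field) \<Rightarrow> real \<Rightarrow> (nat \<Rightarrow> 'a) set" where
  "Lambda1_ball \<alpha> k x \<epsilon> = {y \<in> Lambda1 \<alpha>. Lambda1_norm \<alpha> k (\<lambda>n. y n - x n) < \<epsilon>}"

lemma Lambda1_topology_generated_by_balls:
  "Lambda1_topology \<alpha> =
    topology_generated_by {Lambda1_ball \<alpha> k x \<epsilon> | x k \<epsilon>. x \<in> Lambda1 \<alpha> \<and> k \<ge> 1 \<and> \<epsilon> > 0}"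
  by (simp add: seminorm_topology_def Lambda1_ball_def)

lemma openin_Lambda1_ball:
  "x \<in> Lambda1 \<alpha> \<Longrightarrow> k \<ge> 1 \<Longrightarrow> \<epsilon> > 0 \<Longrightarrow> openin (Lambda1_topology \<alpha>) (Lambda1_ball \<alpha> k x \<epsilon>)"
  unfolding Lambda1_topology_generated_by_balls by (rule topology_generated_by_Basis) blast

lemma centre_in_Lambda1_ball: "x \<in> Lambda1 \<alpha> \<Longrightarrow> \<epsilon> > 0 \<Longrightarrow> x \<in> Lambda1_ball \<alpha> k x \<epsilon>"
  by (simp add: Lambda1_ball_def Lambda1_norm_zero)

lemma Lambda1_ball_mono:
  assumes "x \<in> Lambda1 \<alpha>" "y \<in> Lambda1_ball \<alpha> k x \<epsilon>" "k \<ge> 1"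
    and "\<delta> \<le> \<epsilon> - Lambda1_norm \<alpha> k (\<lambda>n. y n - x n)"
  shows "Lambda1_ball \<alpha> k y \<delta> \<subseteq> Lambda1_ball \<alpha> k x \<epsilon>"
proof
  fix z assume "z \<in> Lambda1_ball \<alpha> k y \<delta>"
  then show "z \<in> Lambda1_ball \<alpha> k x \<epsilon>"
    using assms Lambda1_norm_triangle_diff[of z \<alpha> y x k] by (auto simp: Lambda1_ball_def)
qed

lemma topspace_Lambda1_topology: "topspace (Lambda1_topology \<alpha>) = Lambda1 \<alpha>"
proof
  show "topspace (Lambda1_topology \<alpha>) \<subseteq> Lambda1 \<alpha>"
    unfolding Lambda1_topology_generated_by_balls topology_generated_by_topspace
    by (auto simp: Lambda1_ball_def)
  show "Lambda1 \<alpha> \<subseteq> topspace (Lambda1_topology \<alpha>)"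
    using openin_subset[OF openin_Lambda1_ball, of _ \<alpha> 1 1] centre_in_Lambda1_ball[of _ \<alpha> 1 1]
    by fastforce
qed

text \<open>
  The balls form only a subbase, and their centres need not be the limit point. That convergence in
  every seminorm is nevertheless enough follows by induction over the generation of open sets.
\<close>

lemma limitin_Lambda1_topology_iff:
  assumes f: "\<And>N. f N \<in> Lambda1 \<alpha>"
  shows "limitin (Lambda1_topology \<alpha>) f l sequentially \<longleftrightarrow>
    l \<in> Lambda1 \<alpha> \<and> (\<forall>k\<ge>1. (\<lambda>N. Lambda1_norm \<alpha> k (\<lambda>n. f N n - l n)) \<longlonglongrightarrow> 0)"
proof (intro iffI conjI allI impI)
  assume lim: "limitin (Lambda1_topology \<alpha>) f l sequentially"
  then show l: "l \<in> Lambda1 \<alpha>"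
    by (simp add: limitin_def topspace_Lambda1_topology)
  fix k :: nat assume k: "k \<ge> 1"
  show "(\<lambda>N. Lambda1_norm \<alpha> k (\<lambda>n. f N n - l n)) \<longlonglongrightarrow> 0"
  proof (rule order_tendstoI)
    fix a :: real assume "a < 0"
    then show "\<forall>\<^sub>F N in sequentially. a < Lambda1_norm \<alpha> k (\<lambda>n. f N n - l n)"
      using Lambda1_norm_nonneg[OF Lambda1_diff_closed[OF f l] k]
      by (auto intro: always_eventually less_le_trans)
  next
    fix a :: real assume "0 < a"
    then have "\<forall>\<^sub>F N in sequentially. f N \<in> Lambda1_ball \<alpha> k l a"
      using lim openin_Lambda1_ball[OF l k] centre_in_Lambda1_ball[OF l] by (auto simp: limitin_def)
    then show "\<forall>\<^sub>F N in sequentially. Lambda1_norm \<alpha> k (\<lambda>n. f N n - l n) < a"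
      by (rule eventually_mono) (simp add: Lambda1_ball_def)
  qed
next
  assume "l \<in> Lambda1 \<alpha> \<and> (\<forall>k\<ge>1. (\<lambda>N. Lambda1_norm \<alpha> k (\<lambda>n. f N n - l n)) \<longlonglongrightarrow> 0)"
  then have l: "l \<in> Lambda1 \<alpha>"
    and lim: "\<And>k. k \<ge> 1 \<Longrightarrow> (\<lambda>N. Lambda1_norm \<alpha> k (\<lambda>n. f N n - l n)) \<longlonglongrightarrow> 0"
    by auto
  let ?B = "{Lambda1_ball \<alpha> k x \<epsilon> | x k \<epsilon>. x \<in> Lambda1 \<alpha> \<and> k \<ge> 1 \<and> \<epsilon> > 0}"
  have "generate_topology_on ?B U \<Longrightarrow> l \<in> U \<Longrightarrow> \<forall>\<^sub>F N in sequentially. f N \<in> U" for U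
  proof (induction rule: generate_topology_on.induct)
    case Empty
    then show ?case by simp
  next
    case (Int a b)
    then show ?case by (auto intro: eventually_conj)
  next
    case (UN K)
    then obtain a where "a \<in> K" "l \<in> a" by blast
    with UN.IH have "\<forall>\<^sub>F N in sequentially. f N \<in> a" by blast
    then show ?case by (rule eventually_mono) (use \<open>a \<in> K\<close> in blast)
  next
    case (Basis s)
    then obtain x k \<epsilon> where s: "s = Lambda1_ball \<alpha> k x \<epsilon>" and x: "x \<in> Lambda1 \<alpha>" and k: "k \<ge> 1"
      by blast
    let ?\<delta> = "\<epsilon> - Lambda1_norm \<alpha> k (\<lambda>n. l n - x n)"
    have ls: "l \<in> Lambda1_ball \<alpha> k x \<epsilon>" using Basis.prems s by simp
    then have "0 < ?\<delta>" by (simp add: Lambda1_ball_def)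
    with lim[OF k] have "\<forall>\<^sub>F N in sequentially. Lambda1_norm \<alpha> k (\<lambda>n. f N n - l n) < ?\<delta>"
      by (rule order_tendstoD(2))
    then have "\<forall>\<^sub>F N in sequentially. f N \<in> Lambda1_ball \<alpha> k l ?\<delta>"
      by (rule eventually_mono) (simp add: Lambda1_ball_def f)
    then show ?case
      unfolding s by (rule eventually_mono) (use Lambda1_ball_mono[OF x ls k order_refl] in blast)
  qed
  with l show "limitin (Lambda1_topology \<alpha>) f l sequentially"
    unfolding limitin_def topspace_Lambda1_topology
    by (auto simp: Lambda1_topology_generated_by_balls openin_topology_generated_by_iff)
qed

text \<open>Limits are unique because a seminorm controls every coordinate.\<close>

lemma limitin_Lambda1_topology_unique:
  assumes f: "\<And>N. f N \<in> Lambda1 \<alpha>"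
    and "limitin (Lambda1_topology \<alpha>) f l sequentially" "limitin (Lambda1_topology \<alpha>) f l' sequentially"
  shows "l = l'"
proof
  have coord: "(\<lambda>N. f N i) \<longlonglongrightarrow> m i" if "limitin (Lambda1_topology \<alpha>) f m sequentially" for m i
  proof -
    have m: "m \<in> Lambda1 \<alpha>" and lim: "(\<lambda>N. Lambda1_norm \<alpha> 1 (\<lambda>n. f N n - m n)) \<longlonglongrightarrow> 0"
      using that by (simp_all add: limitin_Lambda1_topology_iff[OF f])
    have "norm (f N i - m i) \<le> Lambda1_norm \<alpha> 1 (\<lambda>n. f N n - m n) * exp (\<alpha> i)" for N
      using norm_coordinate_le_Lambda1_norm[OF Lambda1_diff_closed[OF f m, of N], of 1 i]
      by (simp add: exp_minus field_simps)
    then have "(\<lambda>N. f N i - m i) \<longlonglongrightarrow> 0"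
      by (intro Lim_null_comparison[OF always_eventually[OF allI] tendsto_mult_left_zero[OF lim]])
    then show ?thesis by (simp add: LIM_zero_iff)
  qed
  show "l i = l' i" for i
    using coord assms(2,3) LIMSEQ_unique by blast
qed

lemma series_in_Lambda1_topology_eqI:
  assumes "\<And>N. (\<lambda>i. \<Sum>n\<le>N. f n i) \<in> Lambda1 \<alpha>" "s \<in> Lambda1 \<alpha>"
    and "\<And>k. k \<ge> 1 \<Longrightarrow> (\<lambda>N. Lambda1_norm \<alpha> k (\<lambda>i. (\<Sum>n\<le>N. f n i) - s i)) \<longlonglongrightarrow> 0"
  shows "series_in (Lambda1_topology \<alpha>) f = s"
proof -
  have "limitin (Lambda1_topology \<alpha>) (\<lambda>N i. \<Sum>n\<le>N. f n i) s sequentially"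
    using assms(2,3) by (subst limitin_Lambda1_topology_iff[OF assms(1)]) auto
  then show ?thesis
    unfolding series_in_def
    by (intro the_equality) (auto intro: limitin_Lambda1_topology_unique[OF assms(1)])
qed

lemma continuous_map_Lambda1_topology:
  fixes T :: "(nat \<Rightarrow> 'a::real_normed_field) \<Rightarrow> nat \<Rightarrow> 'b::real_normed_field"
  assumes T: "\<And>x. x \<in> Lambda1 \<alpha> \<Longrightarrow> T x \<in> Lambda1 \<alpha>"
    and bound: "\<And>p. p \<ge> 1 \<Longrightarrow> \<exists>q\<ge>1. \<exists>M>0. \<forall>x\<in>Lambda1 \<alpha>. \<forall>y\<in>Lambda1 \<alpha>.
      Lambda1_norm \<alpha> p (\<lambda>n. T x n - T y n) \<le> M * Lambda1_norm \<alpha> q (\<lambda>n. x n - y n)"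
  shows "continuous_map (Lambda1_topology \<alpha>) (Lambda1_topology \<alpha>) T"
proof -
  let ?B = "{Lambda1_ball \<alpha> k x \<epsilon> | (x :: nat \<Rightarrow> 'b) k \<epsilon>. x \<in> Lambda1 \<alpha> \<and> k \<ge> 1 \<and> \<epsilon> > 0}"
  have "continuous_map (Lambda1_topology \<alpha>) (topology_generated_by ?B) T"
  proof (rule continuous_on_generated_topo)
    have B: "\<Union>?B = Lambda1 \<alpha>"
      by (rule topspace_Lambda1_topology[unfolded Lambda1_topology_generated_by_balls topology_generated_by_topspace])
    show "T ` topspace (Lambda1_topology \<alpha>) \<subseteq> \<Union>?B"
      unfolding B topspace_Lambda1_topology by (rule image_subsetI) (rule T)
    fix U assume "U \<in> ?B"
    then obtain z p \<epsilon> where U: "U = Lambda1_ball \<alpha> p z \<epsilon>" and z: "z \<in> Lambda1 \<alpha>" and p: "p \<ge> 1"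
      by blast
    obtain q M where q: "q \<ge> 1" and M: "M > 0"
      and le: "\<And>x y. x \<in> Lambda1 \<alpha> \<Longrightarrow> y \<in> Lambda1 \<alpha> \<Longrightarrow>
        Lambda1_norm \<alpha> p (\<lambda>n. T x n - T y n) \<le> M * Lambda1_norm \<alpha> q (\<lambda>n. x n - y n)"
      using bound[OF p] by blast
    show "openin (Lambda1_topology \<alpha>) (T -` U \<inter> topspace (Lambda1_topology \<alpha>))"
    proof (subst openin_subopen, intro ballI)
      fix y assume "y \<in> T -` U \<inter> topspace (Lambda1_topology \<alpha>)"
      then have y: "y \<in> Lambda1 \<alpha>" and Ty: "T y \<in> Lambda1_ball \<alpha> p z \<epsilon>"
        by (simp_all add: U topspace_Lambda1_topology)
      let ?\<delta> = "\<epsilon> - Lambda1_norm \<alpha> p (\<lambda>n. T y n - z n)"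
      have \<delta>: "?\<delta> / M > 0" using Ty M by (simp add: Lambda1_ball_def)
      have "T x \<in> Lambda1_ball \<alpha> p (T y) ?\<delta>" if "x \<in> Lambda1_ball \<alpha> q y (?\<delta> / M)" for x
      proof -
        have x: "x \<in> Lambda1 \<alpha>" "M * Lambda1_norm \<alpha> q (\<lambda>n. x n - y n) < ?\<delta>"
          using that M by (auto simp: Lambda1_ball_def field_simps)
        then show ?thesis
          using le[OF x(1) y] T by (simp add: Lambda1_ball_def)
      qed
      then have "Lambda1_ball \<alpha> q y (?\<delta> / M) \<subseteq> T -` U \<inter> topspace (Lambda1_topology \<alpha>)"
        using Lambda1_ball_mono[OF z Ty p order_refl]
        by (auto simp: U topspace_Lambda1_topology) (auto simp: Lambda1_ball_def)
      then show "\<exists>V. openin (Lambda1_topology \<alpha>) V \<and> y \<in> V \<and>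
          V \<subseteq> T -` U \<inter> topspace (Lambda1_topology \<alpha>)"
        using openin_Lambda1_ball[OF y q \<delta>] centre_in_Lambda1_ball[OF y \<delta>] by blast
    qed
  qed
  then show ?thesis by (simp only: Lambda1_topology_generated_by_balls)
qed

section \<open>Convolution\<close>

text \<open>
  Convolution is multiplication of formal power series; commutativity and associativity are
  inherited from the ring of power series.
\<close>

lemma Abs_fps_convolution: "Abs_fps (convolution x y) = Abs_fps x * Abs_fps y"
  by (rule fps_ext) (simp add: fps_mult_nth convolution_def atLeast0AtMost)

lemma convolution_eq_fps_nth: "convolution x y = fps_nth (Abs_fps x * Abs_fps y)"
  by (simp add: Abs_fps_convolution[symmetric] Abs_fps_inverse fun_eq_iff)

lemma convolution_commute: "convolution x y = convolution y x"
  by (simp add: convolution_eq_fps_nth mult.commute)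

lemma convolution_assoc: "convolution (convolution x y) z = convolution x (convolution y z)"
  by (simp add: convolution_eq_fps_nth mult.assoc fps_nth_inverse)

lemma convolution_unit_seq_right: "convolution x (unit_seq n) = (\<lambda>i. if n \<le> i then x (i - n) else 0)"
proof
  fix m
  have "convolution x (unit_seq n) m = (\<Sum>i\<le>m. unit_seq n i * x (m - i))"
    by (simp add: convolution_commute[of x] convolution_def)
  also have "\<dots> = (\<Sum>i\<le>m. if i = n then x (m - n) else 0)"
    by (rule sum.cong) (auto simp: unit_seq_def)
  finally show "convolution x (unit_seq n) m = (if n \<le> m then x (m - n) else 0)"
    by simp
qed

lemma convolution_add_right:
  "convolution x (\<lambda>n. y n + z n) = (\<lambda>n. convolution x y n + convolution x z n)"
  by (rule ext) (simp add: convolution_def distrib_left sum.distrib)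

lemma convolution_diff_right:
  "convolution x (\<lambda>n. y n - z n) = (\<lambda>n. convolution x y n - convolution x z n)"
  by (rule ext) (simp add: convolution_def right_diff_distrib sum_subtractf)

lemma convolution_scale_right: "convolution x (\<lambda>n. c * y n) = (\<lambda>n. c * convolution x y n)"
  by (rule ext) (simp add: convolution_def sum_distrib_left mult.left_commute)

text \<open>
  One factor \<open>exp (- \<alpha>\<^sub>m / p)\<close> has to pay for the weights of both convolution factors. Monotonicity
  gives \<open>\<alpha>\<^sub>i + \<alpha>\<^sub>m\<^sub>-\<^sub>i \<le> 2 \<alpha>\<^sub>m\<close>, so it can be split between them if each weight has half the exponent,
  which is what passing from \<open>p\<close> to \<open>2p\<close> means.
\<close>

lemma
  assumes "incseq \<alpha>" and x: "x \<in> Lambda1 \<alpha>" and y: "y \<in> Lambda1 \<alpha>"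
  shows convolution_in_Lambda1: "convolution x y \<in> Lambda1 \<alpha>"
    and Lambda1_norm_convolution_le:
      "p \<ge> 1 \<Longrightarrow> Lambda1_norm \<alpha> p (convolution x y) \<le> Lambda1_norm \<alpha> (2 * p) x * Lambda1_norm \<alpha> (2 * p) y"
proof -
  let ?w = "\<lambda>k x n. norm (x n :: 'a) * exp (- (1 / real k) * \<alpha> n)"
  have le: "?w p (convolution x y) m \<le> (\<Sum>i\<le>m. ?w (2 * p) x i * ?w (2 * p) y (m - i))"
    if "p \<ge> 1" for p m
  proof -
    have "?w p (convolution x y) m \<le> (\<Sum>i\<le>m. norm (x i * y (m - i))) * exp (- (1 / real p) * \<alpha> m)"
      unfolding convolution_def by (intro mult_right_mono norm_sum) simp
    also have "\<dots> = (\<Sum>i\<le>m. norm (x i) * norm (y (m - i)) * exp (- (1 / real p) * \<alpha> m))"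
      by (simp add: sum_distrib_right norm_mult)
    also have "\<dots> \<le> (\<Sum>i\<le>m. norm (x i) * norm (y (m - i)) *
        (exp (- (1 / real (2 * p)) * \<alpha> i) * exp (- (1 / real (2 * p)) * \<alpha> (m - i))))"
    proof (intro sum_mono mult_left_mono)
      fix i assume "i \<in> {..m}"
      then have "\<alpha> i \<le> \<alpha> m" "\<alpha> (m - i) \<le> \<alpha> m"
        using \<open>incseq \<alpha>\<close> by (auto simp: incseq_def)
      then have "\<alpha> i + \<alpha> (m - i) \<le> 2 * \<alpha> m" by simp
      then show "exp (- (1 / real p) * \<alpha> m)
          \<le> exp (- (1 / real (2 * p)) * \<alpha> i) * exp (- (1 / real (2 * p)) * \<alpha> (m - i))"
        using that by (simp add: exp_add[symmetric] field_simps)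
    qed simp
    also have "\<dots> = (\<Sum>i\<le>m. ?w (2 * p) x i * ?w (2 * p) y (m - i))"
      by (simp add: mult_ac)
    finally show ?thesis .
  qed
  have sum: "summable (\<lambda>n. norm (?w (2 * p) x n))" "summable (\<lambda>n. norm (?w (2 * p) y n))"
    if "p \<ge> 1" for p
    using Lambda1_summable[OF x, of "2 * p"] Lambda1_summable[OF y, of "2 * p"] that by simp_all
  have sum': "summable (?w p (convolution x y))" if "p \<ge> 1" for p
    by (rule summable_comparison_test'[OF summable_Cauchy_product[OF sum[OF that]]])
      (use le[OF that] in auto)
  then show "convolution x y \<in> Lambda1 \<alpha>" by (simp add: Lambda1_def)
  assume p: "p \<ge> 1"
  show "Lambda1_norm \<alpha> p (convolution x y) \<le> Lambda1_norm \<alpha> (2 * p) x * Lambda1_norm \<alpha> (2 * p) y"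
    unfolding Lambda1_norm_def Cauchy_product[OF sum[OF p]]
    by (intro suminf_le le sum' summable_Cauchy_product sum p)
qed

section \<open>The operator is convolution by its symbol\<close>

definition truncate_seq :: "nat \<Rightarrow> (nat \<Rightarrow> 'a::real_normed_field) \<Rightarrow> nat \<Rightarrow> 'a" where
  "truncate_seq N x = (\<lambda>n. if n \<le> N then x n else 0)"

lemma truncate_seq_in_Lambda1: "truncate_seq N x \<in> Lambda1 \<alpha>"
  by (rule finite_support_in_Lambda1[of N]) (simp add: truncate_seq_def)

lemma Lambda1_norm_truncate_seq_tendsto:
  assumes "x \<in> Lambda1 \<alpha>" "k \<ge> 1"
  shows "(\<lambda>N. Lambda1_norm \<alpha> k (\<lambda>n. truncate_seq N x n - x n)) \<longlonglongrightarrow> 0"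
proof -
  let ?w = "\<lambda>n. norm (x n) * exp (- (1 / real k) * \<alpha> n)"
  have sums: "?w sums Lambda1_norm \<alpha> k x"
    unfolding Lambda1_norm_def by (rule summable_sums[OF Lambda1_summable[OF assms]])
  have "Lambda1_norm \<alpha> k (\<lambda>n. truncate_seq N x n - x n) = Lambda1_norm \<alpha> k x - (\<Sum>n\<le>N. ?w n)" for N
  proof -
    have "(\<lambda>n. ?w n - (if n \<in> {..N} then ?w n else 0)) sums (Lambda1_norm \<alpha> k x - (\<Sum>n\<le>N. ?w n))"
      by (intro sums_diff sums sums_If_finite_set) simp
    also have "(\<lambda>n. ?w n - (if n \<in> {..N} then ?w n else 0))
        = (\<lambda>n. norm (truncate_seq N x n - x n) * exp (- (1 / real k) * \<alpha> n))"
      by (auto simp: truncate_seq_def)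
    finally show ?thesis by (simp add: Lambda1_norm_def sums_iff)
  qed
  moreover have "(\<lambda>N. Lambda1_norm \<alpha> k x - (\<Sum>n\<le>N. ?w n)) \<longlonglongrightarrow> Lambda1_norm \<alpha> k x - Lambda1_norm \<alpha> k x"
    using sums by (intro tendsto_diff tendsto_const) (simp add: sums_def_le)
  ultimately show ?thesis by simp
qed

lemma conv_operator_basis_eq_convolution:
  assumes "incseq \<alpha>" and \<theta>: "\<theta> \<in> Lambda1 \<alpha>"
  shows "conv_operator_basis \<alpha> \<theta> n = convolution \<theta> (unit_seq n)"
proof -
  let ?s = "convolution \<theta> (unit_seq n)"
  have s: "?s \<in> Lambda1 \<alpha>"
    by (intro convolution_in_Lambda1 assms unit_seq_in_Lambda1)
  have partial: "(\<lambda>i. \<Sum>j\<le>N. if n \<le> j then \<theta> (j - n) * unit_seq j i else 0) = truncate_seq N ?s" for N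
  proof
    fix i
    have "(\<Sum>j\<le>N. if n \<le> j then \<theta> (j - n) * unit_seq j i else 0)
        = (\<Sum>j\<le>N. if j = i then ?s i else 0)"
      unfolding convolution_unit_seq_right by (rule sum.cong) (auto simp: unit_seq_def)
    then show "(\<Sum>j\<le>N. if n \<le> j then \<theta> (j - n) * unit_seq j i else 0) = truncate_seq N ?s i"
      by (simp add: truncate_seq_def)
  qed
  show ?thesis
    unfolding conv_operator_basis_def
    by (rule series_in_Lambda1_topology_eqI)
      (simp_all only: fun_cong[OF partial] partial truncate_seq_in_Lambda1 s
        Lambda1_norm_truncate_seq_tendsto)
qed

text \<open>
  The \<open>N\<close>-th partial sum of the series for the operator is the convolution of \<open>\<theta>\<close> with the \<open>N\<close>-th
  truncation of \<open>x\<close>, so continuity of convolution gives the limit.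
\<close>

lemma conv_operator_eq_convolution:
  assumes inc: "incseq \<alpha>" and \<theta>: "\<theta> \<in> Lambda1 \<alpha>" and x: "x \<in> Lambda1 \<alpha>"
  shows "conv_operator \<alpha> \<theta> x = convolution \<theta> x"
proof -
  have partial: "(\<lambda>i. \<Sum>n\<le>N. x n * conv_operator_basis \<alpha> \<theta> n i) = convolution \<theta> (truncate_seq N x)" for N
  proof
    fix i
    have "(\<Sum>n\<le>N. x n * conv_operator_basis \<alpha> \<theta> n i) = (\<Sum>n\<le>N. if n \<le> i then x n * \<theta> (i - n) else 0)"
      by (rule sum.cong)
        (auto simp: conv_operator_basis_eq_convolution[OF inc \<theta>] convolution_unit_seq_right)
    also have "\<dots> = (\<Sum>n\<le>i. truncate_seq N x n * \<theta> (i - n))"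
      by (rule sum.mono_neutral_cong) (auto simp: truncate_seq_def)
    finally show "(\<Sum>n\<le>N. x n * conv_operator_basis \<alpha> \<theta> n i) = convolution \<theta> (truncate_seq N x) i"
      by (simp add: convolution_commute[of \<theta>] convolution_def)
  qed
  have "(\<lambda>N. Lambda1_norm \<alpha> k (\<lambda>i. convolution \<theta> (truncate_seq N x) i - convolution \<theta> x i)) \<longlonglongrightarrow> 0"
    if k: "k \<ge> 1" for k
  proof (rule tendsto_sandwich[OF _ _ tendsto_const])
    let ?d = "\<lambda>N n. truncate_seq N x n - x n"
    have d: "?d N \<in> Lambda1 \<alpha>" for N
      by (intro Lambda1_diff_closed truncate_seq_in_Lambda1 x)
    show "(\<lambda>N. Lambda1_norm \<alpha> (2 * k) \<theta> * Lambda1_norm \<alpha> (2 * k) (?d N)) \<longlonglongrightarrow> 0"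
      using k by (intro tendsto_mult_right_zero Lambda1_norm_truncate_seq_tendsto x) simp
    show "\<forall>\<^sub>F N in sequentially. 0 \<le> Lambda1_norm \<alpha> k (\<lambda>i. convolution \<theta> (truncate_seq N x) i - convolution \<theta> x i)"
      unfolding convolution_diff_right[symmetric]
      by (intro always_eventually allI Lambda1_norm_nonneg convolution_in_Lambda1 inc \<theta> d k)
    show "\<forall>\<^sub>F N in sequentially. Lambda1_norm \<alpha> k (\<lambda>i. convolution \<theta> (truncate_seq N x) i - convolution \<theta> x i)
        \<le> Lambda1_norm \<alpha> (2 * k) \<theta> * Lambda1_norm \<alpha> (2 * k) (?d N)"
      unfolding convolution_diff_right[symmetric]
      by (intro always_eventually allI Lambda1_norm_convolution_le inc \<theta> d k)
  qed
  then show ?thesis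
    unfolding conv_operator_def
    by (intro series_in_Lambda1_topology_eqI)
      (simp_all only: fun_cong[OF partial] partial convolution_in_Lambda1 truncate_seq_in_Lambda1 inc \<theta> x)
qed

lemma conv_power_in_Lambda1: "incseq \<alpha> \<Longrightarrow> \<theta> \<in> Lambda1 \<alpha> \<Longrightarrow> conv_power \<theta> k \<in> Lambda1 \<alpha>"
  by (induction k) (simp_all add: unit_seq_in_Lambda1 convolution_in_Lambda1)

lemma conv_operator_funpow_eq_convolution:
  assumes "incseq \<alpha>" "\<theta> \<in> Lambda1 \<alpha>" "x \<in> Lambda1 \<alpha>"
  shows "(conv_operator \<alpha> \<theta> ^^ k) x = convolution (conv_power \<theta> k) x"
proof (induction k)
  case 0
  then show ?case
    using convolution_unit_seq_right[of x 0] by (simp add: convolution_commute[of "unit_seq 0"])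
next
  case (Suc k)
  then show ?case
    using assms by (simp add: conv_operator_eq_convolution convolution_in_Lambda1
        conv_power_in_Lambda1 convolution_assoc)
qed

lemma continuous_linear_conv_operator:
  assumes inc: "incseq \<alpha>" and \<theta>: "\<theta> \<in> Lambda1 \<alpha>"
  shows "continuous_linear_operator (Lambda1 \<alpha>) (Lambda1_norm \<alpha>) (conv_operator \<alpha> \<theta>)"
  unfolding continuous_linear_operator_def
proof (intro conjI ballI allI)
  note eq = conv_operator_eq_convolution[OF inc \<theta>]
  have closed: "conv_operator \<alpha> \<theta> x \<in> Lambda1 \<alpha>" if "x \<in> Lambda1 \<alpha>" for x
    using that by (simp add: eq convolution_in_Lambda1 inc \<theta>)
  then show "conv_operator \<alpha> \<theta> ` Lambda1 \<alpha> \<subseteq> Lambda1 \<alpha>" by blast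
  show "conv_operator \<alpha> \<theta> (\<lambda>n. x n + y n) = (\<lambda>n. conv_operator \<alpha> \<theta> x n + conv_operator \<alpha> \<theta> y n)"
    if "x \<in> Lambda1 \<alpha>" "y \<in> Lambda1 \<alpha>" for x y
    using that by (simp add: eq Lambda1_add_closed convolution_add_right)
  show "conv_operator \<alpha> \<theta> (\<lambda>n. c * x n) = (\<lambda>n. c * conv_operator \<alpha> \<theta> x n)"
    if x: "x \<in> Lambda1 \<alpha>" for c x
  proof -
    have "(\<lambda>n. c * x n) \<in> Lambda1 \<alpha>"
      using summable_mult[OF Lambda1_summable[OF x], of _ "norm c"]
      by (simp add: Lambda1_def norm_mult mult.assoc)
    with x show ?thesis by (simp add: eq convolution_scale_right)
  qed
  show "continuous_map (Lambda1_topology \<alpha>) (Lambda1_topology \<alpha>) (conv_operator \<alpha> \<theta>)"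
  proof (rule continuous_map_Lambda1_topology[OF closed])
    fix p :: nat assume p: "p \<ge> 1"
    \<comment> \<open>The seminorm of the symbol vanishes if the symbol is 0; adding 1 makes the constant positive.\<close>
    have "Lambda1_norm \<alpha> p (\<lambda>n. conv_operator \<alpha> \<theta> x n - conv_operator \<alpha> \<theta> y n)
        \<le> (Lambda1_norm \<alpha> (2 * p) \<theta> + 1) * Lambda1_norm \<alpha> (2 * p) (\<lambda>n. x n - y n)"
      if "x \<in> Lambda1 \<alpha>" "y \<in> Lambda1 \<alpha>" for x y
      using Lambda1_norm_convolution_le[OF inc \<theta> Lambda1_diff_closed[OF that] p]
        Lambda1_norm_nonneg[OF Lambda1_diff_closed[OF that], of "2 * p"] p that
      by (simp add: eq convolution_diff_right distrib_right)
    moreover have "Lambda1_norm \<alpha> (2 * p) \<theta> + 1 > 0"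
      using Lambda1_norm_nonneg[OF \<theta>, of "2 * p"] p by simp
    ultimately show "\<exists>q\<ge>1. \<exists>M>0. \<forall>x\<in>Lambda1 \<alpha>. \<forall>y\<in>Lambda1 \<alpha>.
        Lambda1_norm \<alpha> p (\<lambda>n. conv_operator \<alpha> \<theta> x n - conv_operator \<alpha> \<theta> y n)
          \<le> M * Lambda1_norm \<alpha> q (\<lambda>n. x n - y n)"
      using p by (intro exI[of _ "2 * p"] conjI exI[of _ "Lambda1_norm \<alpha> (2 * p) \<theta> + 1"]) auto
  qed
qed

section \<open>Growth of the iterates\<close>

text \<open>
  Applying the convolution estimate once, to the \<open>k\<close>-th convolution power, keeps the seminorm \<open>2p\<close>
  independent of \<open>k\<close>; applying it \<open>k\<close> times to \<open>\<theta>\<close> would end at the seminorm \<open>2\<^sup>k p\<close>.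
\<close>

lemma Lambda1_norm_conv_operator_funpow_le:
  assumes "incseq \<alpha>" "\<theta> \<in> Lambda1 \<alpha>" "x \<in> Lambda1 \<alpha>" "p \<ge> 1"
  shows "Lambda1_norm \<alpha> p ((conv_operator \<alpha> \<theta> ^^ k) x)
    \<le> Lambda1_norm \<alpha> (2 * p) (conv_power \<theta> k) * Lambda1_norm \<alpha> (2 * p) x"
  using assms by (simp add: conv_operator_funpow_eq_convolution Lambda1_norm_convolution_le
      conv_power_in_Lambda1)

lemma conv_power_eq_funpow_unit_seq:
  assumes "incseq \<alpha>" "\<theta> \<in> Lambda1 \<alpha>"
  shows "conv_power \<theta> k = (conv_operator \<alpha> \<theta> ^^ k) (unit_seq 0)"
  using assms by (simp add: conv_operator_funpow_eq_convolution unit_seq_in_Lambda1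
      convolution_unit_seq_right)

theorem theorem4p1:
  fixes \<alpha> :: "nat \<Rightarrow> real" and \<theta> :: "nat \<Rightarrow> 'a::real_normed_field"
  assumes "\<And>n. 0 \<le> \<alpha> n"
    and "incseq \<alpha>"
    and "filterlim \<alpha> at_top sequentially"
    and "\<theta> \<in> Lambda1 \<alpha>"
  shows "topologizable (Lambda1 \<alpha>) (Lambda1_norm \<alpha>) (conv_operator \<alpha> \<theta>) \<and>
    (m_topologizable (Lambda1 \<alpha>) (Lambda1_norm \<alpha>) (conv_operator \<alpha> \<theta>) \<longleftrightarrow>
      (\<forall>p\<ge>1. \<exists>C>0. \<forall>k\<ge>1. Lambda1_norm \<alpha> p (conv_power \<theta> k) \<le> C ^ k))"
proof (intro conjI iffI allI impI)
  note inc = \<open>incseq \<alpha>\<close> and \<theta> = \<open>\<theta> \<in> Lambda1 \<alpha>\<close>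
  let ?T = "conv_operator \<alpha> \<theta>"
  note clo = continuous_linear_conv_operator[OF inc \<theta>]
  have bound: "Lambda1_norm \<alpha> p ((?T ^^ k) x) \<le> M * Lambda1_norm \<alpha> (2 * p) x"
    if "p \<ge> 1" "x \<in> Lambda1 \<alpha>" "Lambda1_norm \<alpha> (2 * p) (conv_power \<theta> k) \<le> M" for p k x M
    using Lambda1_norm_conv_operator_funpow_le[OF inc \<theta> that(2,1), of k]
      mult_right_mono[OF that(3) Lambda1_norm_nonneg[OF that(2), of "2 * p"]] that(1)
    by simp
  show "topologizable (Lambda1 \<alpha>) (Lambda1_norm \<alpha>) ?T"
    unfolding topologizable_def
  proof (intro conjI clo allI impI)
    fix p :: nat assume p: "p \<ge> 1"
    \<comment> \<open>As above, adding 1 keeps the constant positive when the convolution power is 0.\<close>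
    have "\<exists>M>0. \<forall>x\<in>Lambda1 \<alpha>. Lambda1_norm \<alpha> p ((?T ^^ k) x) \<le> M * Lambda1_norm \<alpha> (2 * p) x" for k
    proof (intro exI[of _ "Lambda1_norm \<alpha> (2 * p) (conv_power \<theta> k) + 1"] conjI ballI)
      show "0 < Lambda1_norm \<alpha> (2 * p) (conv_power \<theta> k) + 1"
        using Lambda1_norm_nonneg[OF conv_power_in_Lambda1[OF inc \<theta>], of "2 * p" k] p by simp
    qed (rule bound[OF p], auto)
    then show "\<exists>q\<ge>1. \<forall>k\<ge>1. \<exists>M>0. \<forall>x\<in>Lambda1 \<alpha>.
        Lambda1_norm \<alpha> p ((?T ^^ k) x) \<le> M * Lambda1_norm \<alpha> q x"
      using p by (intro exI[of _ "2 * p"]) auto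
  qed
  show "m_topologizable (Lambda1 \<alpha>) (Lambda1_norm \<alpha>) ?T"
    if growth: "\<forall>p\<ge>1. \<exists>C>0. \<forall>k\<ge>1. Lambda1_norm \<alpha> p (conv_power \<theta> k) \<le> C ^ k"
    unfolding m_topologizable_def
  proof (intro conjI clo allI impI)
    fix p :: nat assume p: "p \<ge> 1"
    then have "2 * p \<ge> 1" by simp
    with growth obtain C where C: "C > 0" "\<And>k. k \<ge> 1 \<Longrightarrow> Lambda1_norm \<alpha> (2 * p) (conv_power \<theta> k) \<le> C ^ k"
      by blast
    \<comment> \<open>The base \<open>C\<close> may be below 1, whereas m-topologizability asks for a base of at least 1.\<close>
    have "Lambda1_norm \<alpha> (2 * p) (conv_power \<theta> k) \<le> max 1 C ^ k" if "k \<ge> 1" for k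
      using C(2)[OF that] power_mono[of C "max 1 C" k] C(1) by simp
    then have "\<forall>k\<ge>1. \<forall>x\<in>Lambda1 \<alpha>.
        Lambda1_norm \<alpha> p ((?T ^^ k) x) \<le> max 1 C ^ k * Lambda1_norm \<alpha> (2 * p) x"
      using bound[OF p] by blast
    then show "\<exists>q\<ge>1. \<exists>C\<ge>1. \<forall>k\<ge>1. \<forall>x\<in>Lambda1 \<alpha>.
        Lambda1_norm \<alpha> p ((?T ^^ k) x) \<le> C ^ k * Lambda1_norm \<alpha> q x"
      using p by (intro exI[of _ "2 * p"] conjI exI[of _ "max 1 C"]) auto
  qed
  show "\<exists>C>0. \<forall>k\<ge>1. Lambda1_norm \<alpha> p (conv_power \<theta> k) \<le> C ^ k"
    if mtop: "m_topologizable (Lambda1 \<alpha>) (Lambda1_norm \<alpha>) ?T" and p: "p \<ge> 1" for p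
  proof -
    obtain q C where q: "q \<ge> 1" and C: "C \<ge> 1"
      and le: "\<And>k x. k \<ge> 1 \<Longrightarrow> x \<in> Lambda1 \<alpha> \<Longrightarrow>
        Lambda1_norm \<alpha> p ((?T ^^ k) x) \<le> C ^ k * Lambda1_norm \<alpha> q x"
      using mtop p unfolding m_topologizable_def by blast
    have "Lambda1_norm \<alpha> q (unit_seq 0 :: nat \<Rightarrow> 'a) \<le> 1"
      using assms(1)[of 0] by (simp add: Lambda1_norm_unit_seq)
    then have "C ^ k * Lambda1_norm \<alpha> q (unit_seq 0 :: nat \<Rightarrow> 'a) \<le> C ^ k" for k
      using C by (intro mult_right_le_one_le Lambda1_norm_nonneg[OF unit_seq_in_Lambda1 q]) auto
    then have "Lambda1_norm \<alpha> p (conv_power \<theta> k) \<le> C ^ k" if "k \<ge> 1" for k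
      using le[OF that unit_seq_in_Lambda1[of 0]]
      unfolding conv_power_eq_funpow_unit_seq[OF inc \<theta>] by (meson order_trans)
    then show ?thesis using C by (intro exI[of _ C]) auto
  qed
qed

end
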